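(* Let $(M,d)$ be a compact metric space with infinitely many points and let $f\colon M\to M$ be a homeomorphism with h-shadowing. Then $f$ does not have the L-shadowing property. Consequently, $f$ has a shadowing map but does not have an L-shadowing map.
   Context: $\tilde M=M^{\mathbb Z}$ has the product topology; $\sigma\colon\tilde M\to\tilde M$ is the shift, $(\sigma(x))_i=x_{i+1}$; for $p\in M$, $\mathrm{orb}_f(p)\in\tilde M$ is given by $(\mathrm{orb}_f(p))_i=f^i(p)$. For $\delta\ge 0$, $\tilde M(f,\delta)=\{x\in\tilde M: d(x_{i+1},f(x_i))\le\delta\ \forall i\in\mathbb Z\}$; its elements are called $\delta$-orbits. $f$ has h-shadowing if for all $\epsilon>0$ there is $\delta>0$ such that if $x$ is a $\delta$-orbit then $d(f^i(x_0),x_i)\le\epsilon$ for all $i\in\mathbb Z$. A sequence $x\in\tilde M$ is a two-sided limit pseudo-orbit if $d(f(x_i),x_{i+1})\to0$ as $|i|\to\infty$. A point $p\in M$ $\epsilon$-shadows $x$ if $d(f^i(p),x_i)\le\epsilon$ for all $i\in\mathbb Z$, and two-sided limit shadows $x$ if $d(f^i(p),x_i)\to0$ as $|i|\to\infty$. $f$ has the L-shadowing property if for all $\epsilon>0$ there is $\delta>0$ such that for every $\delta$-orbit $x$ that is also a two-sided limit pseudo-orbit there is $p\in M$ that $\epsilon$-shadows and two-sided limit shadows $x$. A pseudo-orbit map for $f$ is a continuous map $\mathrm{Sh}_f\colon\tilde M(f,\delta)\to M$ (for some $\delta>0$) with $\mathrm{Sh}_f(\mathrm{orb}_f(p))=p$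 for all $p\in M$. It is a shadowing map if for all $\epsilon>0$ there is $\gamma\in(0,\delta]$ such that $d(f^i(\mathrm{Sh}_f(x)),\mathrm{Sh}_f(\sigma^i(x)))\le\epsilon$ for all $x\in\tilde M(f,\gamma)$ and $i\in\mathbb Z$. It is an L-shadowing map if for all $\epsilon>0$ there is $\gamma\in(0,\delta]$ such that for every $\gamma$-orbit $x$ that is also a two-sided limit pseudo-orbit, $\mathrm{Sh}_f(x)$ both $\epsilon$-shadows and two-sided limit shadows $x$. *)

theory Defs
  imports "HOL-Analysis.Analysis"
begin

text \<open>
  The compact metric space is the whole type \<open>'a\<close>. The bi-infinite sequence space is the type
  \<open>int \<Rightarrow> 'a\<close>; its \<open>topological_space\<close> instance is the product topology.
\<close>

text \<open>Integer powers, meaningful for bijections only (\<open>inv\<close> is Hilbert choice otherwise).\<close>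

definition int_iter :: "('b \<Rightarrow> 'b) \<Rightarrow> int \<Rightarrow> 'b \<Rightarrow> 'b" where
  "int_iter f i = (if 0 \<le> i then f ^^ nat i else inv f ^^ nat (- i))"

definition shift :: "(int \<Rightarrow> 'a) \<Rightarrow> int \<Rightarrow> 'a" where
  "shift x = (\<lambda>i. x (i + 1))"

definition orb :: "('a \<Rightarrow> 'a) \<Rightarrow> 'a \<Rightarrow> int \<Rightarrow> 'a" where
  "orb f p = (\<lambda>i. int_iter f i p)"

definition delta_orbits :: "('a::metric_space \<Rightarrow> 'a) \<Rightarrow> real \<Rightarrow> (int \<Rightarrow> 'a) set" where
  "delta_orbits f \<delta> = {x. \<forall>i. dist (x (i + 1)) (f (x i)) \<le> \<delta>}"

definition h_shadowing :: "('a::metric_space \<Rightarrow> 'a) \<Rightarrow> bool" where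
  "h_shadowing f \<longleftrightarrow>
     (\<forall>\<epsilon>>0. \<exists>\<delta>>0. \<forall>x\<in>delta_orbits f \<delta>. \<forall>i. dist (int_iter f i (x 0)) (x i) \<le> \<epsilon>)"

text \<open>The filter of the limit \<open>\<bar>i\<bar> \<rightarrow> \<infinity>\<close>; \<open>at_infinity\<close> is not available on \<open>int\<close>.\<close>

definition both_ends :: "int filter" where
  "both_ends = filtercomap abs at_top"

definition two_sided_limit_pseudo_orbit ::
    "('a::metric_space \<Rightarrow> 'a) \<Rightarrow> (int \<Rightarrow> 'a) \<Rightarrow> bool" where
  "two_sided_limit_pseudo_orbit f x \<longleftrightarrow>
     ((\<lambda>i. dist (f (x i)) (x (i + 1))) \<longlongrightarrow> 0) both_ends"

definition eps_shadows ::
    "('a::metric_space \<Rightarrow> 'a) \<Rightarrow> real \<Rightarrow> 'a \<Rightarrow> (int \<Rightarrow> 'a) \<Rightarrow> bool" where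
  "eps_shadows f \<epsilon> p x \<longleftrightarrow> (\<forall>i. dist (int_iter f i p) (x i) \<le> \<epsilon>)"

definition two_sided_limit_shadows ::
    "('a::metric_space \<Rightarrow> 'a) \<Rightarrow> 'a \<Rightarrow> (int \<Rightarrow> 'a) \<Rightarrow> bool" where
  "two_sided_limit_shadows f p x \<longleftrightarrow>
     ((\<lambda>i. dist (int_iter f i p) (x i)) \<longlongrightarrow> 0) both_ends"

definition L_shadowing :: "('a::metric_space \<Rightarrow> 'a) \<Rightarrow> bool" where
  "L_shadowing f \<longleftrightarrow>
     (\<forall>\<epsilon>>0. \<exists>\<delta>>0. \<forall>x\<in>delta_orbits f \<delta>. two_sided_limit_pseudo_orbit f x \<longrightarrow>
        (\<exists>p. eps_shadows f \<epsilon> p x \<and> two_sided_limit_shadows f p x))"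

text \<open>
  A map defined on \<open>delta_orbits f \<delta>\<close> is a total function together with \<open>\<delta>\<close>; its values outside
  that set are never used.
\<close>

definition pseudo_orbit_map ::
    "('a::metric_space \<Rightarrow> 'a) \<Rightarrow> real \<Rightarrow> ((int \<Rightarrow> 'a) \<Rightarrow> 'a) \<Rightarrow> bool" where
  "pseudo_orbit_map f \<delta> Sh \<longleftrightarrow>
     \<delta> > 0 \<and> continuous_on (delta_orbits f \<delta>) Sh \<and> (\<forall>p. Sh (orb f p) = p)"

definition shadowing_map ::
    "('a::metric_space \<Rightarrow> 'a) \<Rightarrow> real \<Rightarrow> ((int \<Rightarrow> 'a) \<Rightarrow> 'a) \<Rightarrow> bool" where
  "shadowing_map f \<delta> Sh \<longleftrightarrow> pseudo_orbit_map f \<delta> Sh \<and>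
     (\<forall>\<epsilon>>0. \<exists>\<gamma>. 0 < \<gamma> \<and> \<gamma> \<le> \<delta> \<and>
        (\<forall>x\<in>delta_orbits f \<gamma>. \<forall>i.
           dist (int_iter f i (Sh x)) (Sh (int_iter shift i x)) \<le> \<epsilon>))"

definition L_shadowing_map ::
    "('a::metric_space \<Rightarrow> 'a) \<Rightarrow> real \<Rightarrow> ((int \<Rightarrow> 'a) \<Rightarrow> 'a) \<Rightarrow> bool" where
  "L_shadowing_map f \<delta> Sh \<longleftrightarrow> pseudo_orbit_map f \<delta> Sh \<and>
     (\<forall>\<epsilon>>0. \<exists>\<gamma>. 0 < \<gamma> \<and> \<gamma> \<le> \<delta> \<and>
        (\<forall>x\<in>delta_orbits f \<gamma>. two_sided_limit_pseudo_orbit f x \<longrightarrow>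
           eps_shadows f \<epsilon> (Sh x) x \<and> two_sided_limit_shadows f (Sh x) x))"

end

theory Submission
  imports Defs
begin

text \<open>
  Splice the backward orbit of \<open>p\<close> to the forward orbit of \<open>q\<close>. The only jump of this sequence is
  from \<open>p\<close> to \<open>q\<close>, so it is a two-sided limit pseudo-orbit, and a \<open>\<delta>\<close>-orbit if
  \<open>dist q p \<le> \<delta>\<close>. It is used twice.

  Under h-shadowing the spliced sequence must stay close to the orbit of its own zeroth entry \<open>q\<close>.
  Hence close points have close backward orbits; moving the jump one step further gives the same for
  forward orbits. So the family of all integer iterates of \<open>f\<close> is uniformly equicontinuous
  (\<open>h_shadowing_imp_equicontinuous\<close>). In such a system distinct points stay apart: if the iterates
  of two points come arbitrarily close at some times, pulling back shows that the points were equal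
  (\<open>equicontinuous_proximal_eq\<close>).

  Under L-shadowing, some \<open>z\<close> is asymptotic to \<open>p\<close> in the past and to \<open>q\<close> in the future, so by
  equicontinuity \<open>p = z = q\<close>. L-shadowing would thus give a positive lower bound for the distances of
  distinct points, which is impossible in an infinite compact space.

  An L-shadowing map hands out the shadowing points that the L-shadowing property asks for, so it
  cannot exist either. The evaluation \<open>x \<mapsto> x 0\<close>, on the other hand, is a shadowing map: since
  \<open>\<sigma>\<^sup>i x\<close> has zeroth entry \<open>x i\<close>, the estimate required of it is h-shadowing itself.
\<close>

section \<open>Integer iterates\<close>

lemma int_iter_0 [simp]: "int_iter f 0 p = p"
  by (simp add: int_iter_def)

lemma int_iter_add_1:
  assumes "bij f"
  shows "int_iter f (i + 1) p = f (int_iter f i p)"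
proof (cases "0 \<le> i")
  case True
  then show ?thesis by (simp add: int_iter_def nat_add_distrib)
next
  case False
  then obtain n where n: "i = - int (Suc n)"
    by (metis linorder_not_le negD)
  have "f (inv f y) = y" for y
    using assms by (simp add: bij_is_surj surj_f_inv_f)
  then show ?thesis
    by (simp add: int_iter_def n nat_add_distrib)
qed

lemma int_iter_add:
  assumes "bij f"
  shows "int_iter f (i + j) p = int_iter f i (int_iter f j p)"
proof (induction i rule: int_induct [where k = 0])
  case base
  show ?case by simp
next
  case (step1 i)
  then show ?case
    using int_iter_add_1 [OF assms, of "i + j" p] int_iter_add_1 [OF assms, of i "int_iter f j p"]
    by (simp add: algebra_simps)
next
  case (step2 i)
  have "f (int_iter f (i - 1 + j) p) = f (int_iter f (i - 1) (int_iter f j p))"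
    using step2 int_iter_add_1 [OF assms, of "i - 1 + j" p]
      int_iter_add_1 [OF assms, of "i - 1" "int_iter f j p"]
    by (simp add: algebra_simps)
  then show ?case
    using assms by (simp add: bij_is_inj inj_eq)
qed

lemma bij_shift: "bij shift"
proof (rule bij_betw_byWitness [where f' = "\<lambda>x i. x (i - 1)"])
qed (auto simp: shift_def)

lemma int_iter_shift: "int_iter shift i x j = x (j + i)"
proof (induction i arbitrary: j rule: int_induct [where k = 0])
  case base
  show ?case by simp
next
  case (step1 i)
  have "int_iter shift (i + 1) x j = int_iter shift i x (j + 1)"
    by (subst int_iter_add_1 [OF bij_shift]) (simp add: shift_def [of "int_iter shift i x"])
  then show ?case
    using step1 by (simp add: algebra_simps)
next
  case (step2 i)
  have "int_iter shift i x = shift (int_iter shift (i - 1) x)"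
    using int_iter_add_1 [OF bij_shift, of "i - 1" x] by simp
  then have "int_iter shift i x (j - 1) = int_iter shift (i - 1) x j"
    by (simp add: shift_def)
  then show ?case
    using step2(2) [of "j - 1"] by (simp add: algebra_simps)
qed

section \<open>Sequences that change orbit once\<close>

text \<open>
  The position of the jump is a parameter because h-shadowing compares a sequence with the orbit of
  its zeroth entry: \<open>k = 0\<close> makes that entry \<open>q\<close>, and \<open>k = 1\<close> makes it \<open>p\<close>.
\<close>

definition splice :: "('a \<Rightarrow> 'a) \<Rightarrow> int \<Rightarrow> 'a \<Rightarrow> 'a \<Rightarrow> int \<Rightarrow> 'a" where
  "splice f k p q = (\<lambda>i. int_iter f i (if i < k then p else q))"

lemma splice_step:
  assumes "bij f" "i + 1 \<noteq> k"
  shows "splice f k p q (i + 1) = f (splice f k p q i)"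
  using assms by (auto simp: splice_def int_iter_add_1)

lemma splice_jump:
  assumes "bij f"
  shows "f (splice f k p q (k - 1)) = int_iter f k p"
  using int_iter_add_1 [OF assms, of "k - 1" p] by (simp add: splice_def)

lemma splice_in_delta_orbits:
  fixes f :: "'a::metric_space \<Rightarrow> 'a"
  assumes "bij f" "dist (int_iter f k q) (int_iter f k p) \<le> \<delta>"
  shows "splice f k p q \<in> delta_orbits f \<delta>"
proof -
  have "0 \<le> \<delta>" using assms(2) zero_le_dist order_trans by blast
  have "dist (splice f k p q (i + 1)) (f (splice f k p q i)) \<le> \<delta>" for i
  proof (cases "i + 1 = k")
    case True
    then have "i = k - 1" by simp
    then show ?thesis
      using assms(2) by (simp add: splice_jump [OF assms(1)]) (simp add: splice_def)
  qed (simp add: splice_step [OF assms(1)] \<open>0 \<le> \<delta>\<close>)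
  then show ?thesis by (simp add: delta_orbits_def)
qed

lemma eventually_both_ends:
  "eventually P both_ends \<longleftrightarrow> (\<exists>N. \<forall>i. N \<le> \<bar>i\<bar> \<longrightarrow> P i)"
  by (simp add: both_ends_def eventually_filtercomap_at_top_linorder)

lemma splice_limit_pseudo_orbit:
  fixes f :: "'a::metric_space \<Rightarrow> 'a"
  assumes "bij f"
  shows "two_sided_limit_pseudo_orbit f (splice f k p q)"
proof -
  have "\<forall>i. \<bar>k\<bar> + 2 \<le> \<bar>i\<bar> \<longrightarrow> dist (f (splice f k p q i)) (splice f k p q (i + 1)) = 0"
    using splice_step [OF assms] by force
  then show ?thesis
    unfolding two_sided_limit_pseudo_orbit_def
    by (intro tendsto_eventually) (unfold eventually_both_ends, blast)
qed

section \<open>Equicontinuity\<close>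

text \<open>
  To compare backward iterates, the jump is placed at index \<open>0\<close>, so that the entries at negative
  indices and the zeroth entry belong to different orbits. For forward iterates it must
  come after index \<open>0\<close>; the jump at index \<open>1\<close> has the size of the distance of the images, which
  is where uniform continuity of \<open>f\<close> enters.
\<close>

lemma h_shadowing_imp_equicontinuous:
  fixes f :: "'a::metric_space \<Rightarrow> 'a"
  assumes "bij f" "uniformly_continuous_on UNIV f" "h_shadowing f" "\<epsilon> > 0"
  obtains \<delta> where "\<delta> > 0"
    "\<And>p q i. dist p q < \<delta> \<Longrightarrow> dist (int_iter f i p) (int_iter f i q) \<le> \<epsilon>"
proof -
  obtain \<eta> where "\<eta> > 0"
    and \<eta>: "\<And>x i. x \<in> delta_orbits f \<eta> \<Longrightarrow> dist (int_iter f i (x 0)) (x i) \<le> \<epsilon>"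
    using assms(3,4) unfolding h_shadowing_def by meson
  obtain \<delta> where "\<delta> > 0" and \<delta>: "\<And>p q. dist p q < \<delta> \<Longrightarrow> dist (f p) (f q) < \<eta>"
    using assms(2) \<open>\<eta> > 0\<close> unfolding uniformly_continuous_on_def by (metis UNIV_I)
  \<comment> \<open>The bound by \<open>\<epsilon>\<close> covers \<open>i = 0\<close>, which neither splice compares.\<close>
  have "dist (int_iter f i p) (int_iter f i q) \<le> \<epsilon>" if "dist p q < Min {\<delta>, \<eta>, \<epsilon>}" for p q i
  proof (cases "i < 0")
    case True
    have "splice f 0 q p \<in> delta_orbits f \<eta>"
      using that by (intro splice_in_delta_orbits [OF assms(1)]) simp
    from \<eta> [OF this, of i] True show ?thesis by (simp add: splice_def)
  next
    case False
    have "dist (f q) (f p) \<le> \<eta>"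
      using \<delta> [of q p] that by (simp add: dist_commute)
    then have "splice f 1 p q \<in> delta_orbits f \<eta>"
      using int_iter_add_1 [OF assms(1), of 0]
      by (intro splice_in_delta_orbits [OF assms(1)]) simp
    from \<eta> [OF this, of i] False that show ?thesis
      by (cases "i = 0") (auto simp: splice_def)
  qed
  with \<open>\<delta> > 0\<close> \<open>\<eta> > 0\<close> \<open>\<epsilon> > 0\<close> show thesis
    by (intro that [of "Min {\<delta>, \<eta>, \<epsilon>}"]) auto
qed

text \<open>
  If \<open>f\<^sup>i p\<close> and \<open>f\<^sup>i q\<close> are very close, applying \<open>f\<^sup>-\<^sup>i\<close> keeps them close, uniformly in
  \<open>i\<close>. One such time for each distance suffices, so the lemma serves both ends of an orbit.
\<close>

lemma equicontinuous_proximal_eq: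
  fixes f :: "'a::metric_space \<Rightarrow> 'a"
  assumes "bij f" "uniformly_continuous_on UNIV f" "h_shadowing f"
    and proximal: "\<And>\<delta>. \<delta> > 0 \<Longrightarrow> \<exists>i. dist (int_iter f i p) (int_iter f i q) < \<delta>"
  shows "p = q"
proof (rule ccontr)
  assume "p \<noteq> q"
  then have "dist p q / 2 > 0" by simp
  then obtain \<delta> where "\<delta> > 0"
    and \<delta>: "\<And>x y i. dist x y < \<delta> \<Longrightarrow> dist (int_iter f i x) (int_iter f i y) \<le> dist p q / 2"
    by (rule h_shadowing_imp_equicontinuous [OF assms(1-3)]) blast
  obtain i where "dist (int_iter f i p) (int_iter f i q) < \<delta>"
    using proximal [OF \<open>\<delta> > 0\<close>] by blast
  from \<delta> [OF this, of "- i"] have "dist p q \<le> dist p q / 2"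
    by (simp flip: int_iter_add [OF assms(1)])
  with \<open>dist p q / 2 > 0\<close> show False by simp
qed

section \<open>L-shadowing and shadowing maps\<close>

lemma splice_limit_shadowed_imp_eq:
  fixes f :: "'a::metric_space \<Rightarrow> 'a"
  assumes "bij f" "uniformly_continuous_on UNIV f" "h_shadowing f"
    and z: "two_sided_limit_shadows f z (splice f 0 p q)"
  shows "p = q"
proof -
  have close: "\<exists>N. \<forall>i. N \<le> \<bar>i\<bar> \<longrightarrow> dist (int_iter f i z) (splice f 0 p q i) < \<delta>"
    if "\<delta> > 0" for \<delta>
    using tendstoD [OF z [unfolded two_sided_limit_shadows_def] that]
    by (simp add: eventually_both_ends)
  have "z = p"
  proof (rule equicontinuous_proximal_eq [OF assms(1-3)])
    fix \<delta> :: real assume "\<delta> > 0"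
    with close obtain N where N: "\<forall>i. N \<le> \<bar>i\<bar> \<longrightarrow> dist (int_iter f i z) (splice f 0 p q i) < \<delta>"
      by blast
    have "- \<bar>N\<bar> - 1 < 0" "N \<le> \<bar>- \<bar>N\<bar> - 1\<bar>" by auto
    with N show "\<exists>i. dist (int_iter f i z) (int_iter f i p) < \<delta>"
      unfolding splice_def by metis
  qed
  moreover have "z = q"
  proof (rule equicontinuous_proximal_eq [OF assms(1-3)])
    fix \<delta> :: real assume "\<delta> > 0"
    with close obtain N where N: "\<forall>i. N \<le> \<bar>i\<bar> \<longrightarrow> dist (int_iter f i z) (splice f 0 p q i) < \<delta>"
      by blast
    have "\<not> \<bar>N\<bar> < 0" "N \<le> \<bar>\<bar>N\<bar>\<bar>" by auto
    with N show "\<exists>i. dist (int_iter f i z) (int_iter f i q) < \<delta>"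
      unfolding splice_def by metis
  qed
  ultimately show ?thesis by simp
qed

lemma infinite_compact_close_points:
  fixes \<delta> :: real
  assumes "compact (UNIV :: 'a set)" "infinite (UNIV :: 'a set)" "\<delta> > 0"
  obtains p q :: "'a::metric_space" where "p \<noteq> q" "dist p q < \<delta>"
proof -
  obtain p :: 'a where "p islimpt UNIV"
    using Heine_Borel_imp_Bolzano_Weierstrass [OF assms(1,2)] by auto
  with assms(3) show thesis
    unfolding islimpt_approachable by (metis that)
qed

lemma h_shadowing_imp_not_L_shadowing:
  fixes f :: "'a::metric_space \<Rightarrow> 'a"
  assumes "compact (UNIV :: 'a set)" "infinite (UNIV :: 'a set)"
    and "bij f" "continuous_on UNIV f" "h_shadowing f"
  shows "\<not> L_shadowing f"
proof
  assume "L_shadowing f"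
  \<comment> \<open>The accuracy \<open>1\<close> is arbitrary: the contradiction comes from the limit behaviour.\<close>
  then obtain \<delta> where "\<delta> > 0"
    and \<delta>: "\<And>x. x \<in> delta_orbits f \<delta> \<Longrightarrow> two_sided_limit_pseudo_orbit f x \<Longrightarrow>
      \<exists>p. two_sided_limit_shadows f p x"
    unfolding L_shadowing_def by (meson zero_less_one)
  obtain p q :: 'a where "p \<noteq> q" "dist p q < \<delta>"
    using infinite_compact_close_points [OF assms(1,2) \<open>\<delta> > 0\<close>] .
  have "splice f 0 p q \<in> delta_orbits f \<delta>"
    using \<open>dist p q < \<delta>\<close>
    by (intro splice_in_delta_orbits [OF assms(3)]) (simp add: dist_commute)
  then obtain z where "two_sided_limit_shadows f z (splice f 0 p q)"
    using \<delta> splice_limit_pseudo_orbit [OF assms(3)] by blast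
  then have "p = q"
    using splice_limit_shadowed_imp_eq assms(3,5) compact_uniformly_continuous [OF assms(4,1)]
    by blast
  with \<open>p \<noteq> q\<close> show False ..
qed

lemma L_shadowing_map_imp_L_shadowing: "L_shadowing_map f \<delta> Sh \<Longrightarrow> L_shadowing f"
  unfolding L_shadowing_map_def L_shadowing_def by meson

lemma h_shadowing_imp_shadowing_map:
  fixes f :: "'a::metric_space \<Rightarrow> 'a"
  assumes "h_shadowing f"
  shows "shadowing_map f 1 (\<lambda>x. x 0)"
proof -
  have "pseudo_orbit_map f 1 (\<lambda>x. x 0)"
    by (simp add: pseudo_orbit_map_def orb_def continuous_on_product_coordinates
        continuous_on_subset [OF continuous_on_product_coordinates])
  moreover have "\<exists>\<gamma>. 0 < \<gamma> \<and> \<gamma> \<le> 1 \<and> (\<forall>x\<in>delta_orbits f \<gamma>. \<forall>i.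
      dist (int_iter f i (x 0)) (int_iter shift i x 0) \<le> \<epsilon>)" if "\<epsilon> > 0" for \<epsilon>
  proof -
    obtain \<eta> where "\<eta> > 0"
      and \<eta>: "\<forall>x\<in>delta_orbits f \<eta>. \<forall>i. dist (int_iter f i (x 0)) (x i) \<le> \<epsilon>"
      using assms \<open>\<epsilon> > 0\<close> unfolding h_shadowing_def by meson
    moreover have "delta_orbits f (min \<eta> 1) \<subseteq> delta_orbits f \<eta>"
      by (auto simp: delta_orbits_def)
    ultimately show ?thesis
      by (intro exI [of _ "min \<eta> 1"]) (auto simp: int_iter_shift)
  qed
  ultimately show ?thesis by (simp add: shadowing_map_def)
qed

theorem proposition4p11:
  fixes f :: "'a::metric_space \<Rightarrow> 'a"
  assumes "compact (UNIV :: 'a set)"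
    and "infinite (UNIV :: 'a set)"
    and "homeomorphism UNIV UNIV f (inv f)"
    and "h_shadowing f"
  shows "\<not> L_shadowing f \<and>
    (\<exists>\<delta> Sh. shadowing_map f \<delta> Sh) \<and>
    \<not> (\<exists>\<delta> Sh. L_shadowing_map f \<delta> Sh)"
proof -
  have "continuous_on UNIV f"
    using assms(3) by (simp add: homeomorphism_def)
  moreover have "bij f"
    using assms(3) by (intro bij_betw_byWitness [where f' = "inv f"]) (auto simp: homeomorphism_def)
  ultimately have "\<not> L_shadowing f"
    using h_shadowing_imp_not_L_shadowing assms(1,2,4) by blast
  then show ?thesis
    using h_shadowing_imp_shadowing_map [OF assms(4)] L_shadowing_map_imp_L_shadowing by blast
qed

end
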